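(* Let $(V,\mathcal{A})$ be a hyperplane arrangement over a subfield $k\subseteq\mathbb{C}$ with enough modular elements. Then $(V,\mathcal{A})$ is supersolvable.
   Context: A hyperplane arrangement $(V,\mathcal{A})$ over $k$ is a finite-dimensional $k$-vector space $V$ with a non-empty finite set $\mathcal{A}$ of one-dimensional subspaces of $V^*$. $L(\mathcal{A})$ is the set of all subspaces of $V^*$ that are sums of elements of $\mathcal{A}$ (including $0$), ordered by inclusion. The arrangement is essential if $V^*\in L(\mathcal{A})$. $M\in L(\mathcal{A})$ is modular if $M\cap Y\in L(\mathcal{A})$ for all $Y\in L(\mathcal{A})$. $(V,\mathcal{A})$ has enough modular elements if for every $H\in\mathcal{A}$ there is a modular $M\in L(\mathcal{A})$ of codimension $1$ in $V^*$ with $H\not\subseteq M$. With $\dim V=l+1$, the arrangement is supersolvable if it is essential and there is a maximal chain $0=X_0\subsetneq X_1\subsetneq\dots\subsetneq X_{l+1}=V^*$ of modular elements of $L(\mathcal{A})$ (so $\dim X_i=i$). *)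

theory Defs
  imports Complex_Main "HOL-Library.Function_Algebras"
begin

text \<open>The subfields of the complex numbers are the images of fields under the following maps
  (homomorphisms of fields are injective); a field \<open>'k\<close> together with such a map
  represents a subfield \<open>k\<close> of the complex numbers.\<close>

definition complex_embedding :: "('k::field \<Rightarrow> complex) \<Rightarrow> bool" where
  "complex_embedding \<iota> \<longleftrightarrow>
     \<iota> 1 = 1 \<and> (\<forall>x y. \<iota> (x + y) = \<iota> x + \<iota> y) \<and> (\<forall>x y. \<iota> (x * y) = \<iota> x * \<iota> y)"

definition fun_scale :: "'k::field \<Rightarrow> ('v \<Rightarrow> 'k) \<Rightarrow> 'v \<Rightarrow> 'k" where
  "fun_scale c f = (\<lambda>x. c * f x)"

global_interpretation fun_space:
  vector_space "fun_scale :: 'k::field \<Rightarrow> ('v \<Rightarrow> 'k) \<Rightarrow> 'v \<Rightarrow> 'k"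
  by unfold_locales (auto simp: fun_scale_def algebra_simps)

text \<open>The dual space is a subspace of the space of all functions from \<open>V\<close> to \<open>k\<close>; the linear
  structure on the latter is the one provided by \<open>fun_space\<close>.\<close>

definition dual_space :: "('k::field \<Rightarrow> 'v::ab_group_add \<Rightarrow> 'v) \<Rightarrow> ('v \<Rightarrow> 'k) set" where
  "dual_space scale = {f. Vector_Spaces.linear scale (*) f}"

locale hyperplane_arrangement = vector_space scale
  for scale :: "'k::field \<Rightarrow> 'v::ab_group_add \<Rightarrow> 'v" +
  fixes A :: "('v \<Rightarrow> 'k) set set"
  assumes finite_dimensional: "\<exists>B. finite B \<and> span B = UNIV"
    and finite_A: "finite A"
    and nonempty_A: "A \<noteq> {}"
    and subspace_A: "H \<in> A \<Longrightarrow> fun_space.subspace H"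
    and dual_A: "H \<in> A \<Longrightarrow> H \<subseteq> dual_space scale"
    and dim_A: "H \<in> A \<Longrightarrow> fun_space.dim H = 1"
begin

text \<open>The sum of a family of subspaces is the span of its union, the empty sum being \<open>{0}\<close>.\<close>

definition L :: "('v \<Rightarrow> 'k) set set" where
  "L = {fun_space.span (\<Union>B) | B. B \<subseteq> A}"

definition essential :: bool where
  "essential \<longleftrightarrow> dual_space scale \<in> L"

definition modular :: "('v \<Rightarrow> 'k) set \<Rightarrow> bool" where
  "modular M \<longleftrightarrow> M \<in> L \<and> (\<forall>Y\<in>L. M \<inter> Y \<in> L)"

definition enough_modular_elements :: bool where
  "enough_modular_elements \<longleftrightarrow>
     (\<forall>H\<in>A. \<exists>M. modular M \<and> fun_space.dim M + 1 = fun_space.dim (dual_space scale) \<and> \<not> H \<subseteq> M)"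

text \<open>Here \<open>dim UNIV\<close> is the dimension of \<open>V\<close>, and \<open>subset.maxchain L\<close> holds of the chains
  in \<open>L\<close> with respect to inclusion that are maximal among all chains in \<open>L\<close>.\<close>

definition supersolvable :: bool where
  "supersolvable \<longleftrightarrow> essential \<and>
     (\<exists>X :: nat \<Rightarrow> ('v \<Rightarrow> 'k) set.
        X 0 = {0} \<and> X (dim UNIV) = dual_space scale \<and>
        (\<forall>i<dim UNIV. X i \<subset> X (Suc i)) \<and>
        (\<forall>i\<le>dim UNIV. modular (X i)) \<and>
        subset.maxchain L (X ` {..dim UNIV}))"

end

end

theory Submission
  imports Defs
begin

text \<open>An intersection of modular elements is modular. A nonzero element \<open>X\<close> of \<open>L\<close> contains some
  \<open>H \<in> A\<close>, hence is not contained in some modular \<open>M\<close> of codimension \<open>1\<close>, and then \<open>X \<inter> M\<close> has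
  codimension \<open>1\<close> in \<open>X\<close>. Starting from the dual space and intersecting repeatedly gives the chain.
  The chain is maximal since it contains an element of each possible dimension.\<close>

lemma sum_fun_apply: "(\<Sum>i\<in>I. f i) x = (\<Sum>i\<in>I. f i x)"
  by (induction I rule: infinite_finite_induct) auto

section \<open>Dimension inside a finitely spanned subspace\<close>

context vector_space
begin

lemma dim_zero: "dim {0} = 0"
  using dim_unique[of "{}" "{0}" 0] by (simp add: independent_empty)

lemma finite_basis_exists:
  assumes "finite T" "S \<subseteq> span T"
  obtains B where "B \<subseteq> S" "independent B" "S \<subseteq> span B" "finite B" "card B = dim S"
  using basis_exists[of S] independent_span_bound[OF assms(1)] assms(2)
  by (metis order_trans)

text \<open>The space of all functions on \<open>V\<close> may be infinite-dimensional, so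
  finiteness enters through a finite \<open>T\<close> whose span contains the sets in question. Such
  a bound matters because \<open>dim\<close> is the \<open>card\<close> of a basis, which is 0 for
  an infinite one.\<close>

lemma dim_subset_finitely_spanned:
  assumes "finite T" "R \<subseteq> span T" "S \<subseteq> R"
  shows "dim S \<le> dim R"
proof -
  obtain B where B: "B \<subseteq> R" "R \<subseteq> span B" "finite B" "card B = dim R"
    using finite_basis_exists[OF assms(1,2)] by metis
  have "S \<subseteq> span T" using assms by blast
  then obtain C where C: "C \<subseteq> S" "independent C" "card C = dim S"
    using finite_basis_exists[OF assms(1)] by metis
  have "C \<subseteq> span B" using B C assms by blast
  then show ?thesis using independent_span_bound[OF B(3) C(2)] B C by simp
qed

text \<open>Otherwise a basis of \<open>S\<close> could be extended by a vector of \<open>R\<close>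
  outside \<open>S\<close>, giving \<open>dim R + 1\<close> independent vectors in
  \<open>R\<close>.\<close>

lemma subspace_dim_equal_finitely_spanned:
  assumes "finite T" "R \<subseteq> span T" "S \<subseteq> R" "subspace S" "dim S = dim R"
  shows "S = R"
proof (rule ccontr)
  assume "S \<noteq> R"
  then obtain a where a: "a \<in> R" "a \<notin> S" using assms by blast
  have "S \<subseteq> span T" using assms by blast
  then obtain C where C: "C \<subseteq> S" "independent C" "S \<subseteq> span C" "finite C" "card C = dim S"
    using finite_basis_exists[OF assms(1)] by metis
  obtain B where B: "B \<subseteq> R" "R \<subseteq> span B" "finite B" "card B = dim R"
    using finite_basis_exists[OF assms(1,2)] by metis
  have sC: "span C = S" using C assms span_minimal by blast
  then have "independent (insert a C)" using a C by (simp add: independent_insert)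
  moreover have "insert a C \<subseteq> span B" using a B C assms by blast
  ultimately have "card (insert a C) \<le> card B" using independent_span_bound[OF B(3)] by blast
  moreover have "a \<notin> C" using a C by blast
  ultimately show False using C B assms by simp
qed

text \<open>The span lies between \<open>M\<close> and \<open>W\<close> and differs from
  \<open>M\<close>, so its dimension is above \<open>dim M\<close> and at most
  \<open>dim M + 1\<close>.\<close>

lemma span_insert_codim_1:
  assumes "finite T" "W \<subseteq> span T" "subspace W" "subspace M" "M \<subseteq> W"
    and "dim M + 1 = dim W" "a \<in> W" "a \<notin> M"
  shows "span (insert a M) = W"
proof (rule subspace_dim_equal_finitely_spanned[OF assms(1,2)])
  show sub: "span (insert a M) \<subseteq> W" using assms by (intro span_minimal) auto
  then have fin: "span (insert a M) \<subseteq> span T" using assms by blast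
  have "dim M \<noteq> dim (span (insert a M))"
    using subspace_dim_equal_finitely_spanned[OF assms(1) fin, of M] assms span_superset
    by (metis insert_subset)
  moreover have "dim M \<le> dim (span (insert a M))"
    using span_superset by (intro dim_subset_finitely_spanned[OF assms(1) fin]) blast
  moreover have "dim (span (insert a M)) \<le> dim W"
    by (rule dim_subset_finitely_spanned[OF assms(1,2) sub])
  ultimately show "dim (span (insert a M)) = dim W" using assms by linarith
qed (rule subspace_span)

text \<open>Any \<open>a\<close> in \<open>S\<close> outside \<open>M\<close> spans \<open>W\<close>
  modulo \<open>M\<close>, hence also \<open>S\<close> modulo \<open>S \<inter> M\<close>. So
  \<open>a\<close> completes a basis of \<open>S \<inter> M\<close> to a basis of
  \<open>S\<close>.\<close>

lemma dim_Int_codim_1: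
  assumes "finite T" "W \<subseteq> span T" "subspace W" "subspace M" "M \<subseteq> W"
    and "dim M + 1 = dim W" "subspace S" "S \<subseteq> W" "\<not> S \<subseteq> M"
  shows "dim (S \<inter> M) + 1 = dim S"
proof -
  obtain a where a: "a \<in> S" "a \<notin> M" using assms by blast
  have W: "span (insert a M) = W"
    using a assms by (intro span_insert_codim_1[OF assms(1-6)]) auto
  have "S \<inter> M \<subseteq> span T" using assms by blast
  then obtain B where B: "B \<subseteq> S \<inter> M" "independent B" "S \<inter> M \<subseteq> span B" "finite B"
      "card B = dim (S \<inter> M)"
    using finite_basis_exists[OF assms(1)] by metis
  have sB: "span B = S \<inter> M"
    using B assms span_minimal[of B "S \<inter> M"] by (auto simp: subspace_inter)
  have ind: "independent (insert a B)" using a B sB by (simp add: independent_insert)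
  have "S \<subseteq> span (insert a B)"
  proof
    fix s assume s: "s \<in> S"
    \<comment> \<open>The remainder of \<open>s\<close> after subtracting a multiple of
      \<open>a\<close> lies in \<open>M\<close>, and also in \<open>S\<close>, since
      \<open>s\<close> and \<open>a\<close> do.\<close>
    then have "s \<in> span (insert a M)" using W assms by blast
    then obtain k where k: "s - scale k a \<in> span M" by (auto simp: span_insert)
    have "s - scale k a \<in> S" using s a assms by (simp add: subspace_diff subspace_scale)
    moreover have "s - scale k a \<in> M" using k assms by (metis span_eq_iff)
    ultimately show "s \<in> span (insert a B)" using sB by (auto simp: span_insert)
  qed
  moreover have "insert a B \<subseteq> S" using a B by blast
  ultimately have "dim S = card (insert a B)" using ind by (metis dim_unique)
  moreover have "a \<notin> B" using a B by blast
  ultimately show ?thesis using B by simp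
qed

section \<open>The dual basis\<close>

text \<open>\<open>D\<close> consists of the coordinate functionals of \<open>B\<close>. This
  identifies the dimension of the dual space with that of \<open>V\<close>.\<close>

lemma dual_space_basis:
  assumes "finite B" "independent B" "span B = UNIV"
  defines "D \<equiv> (\<lambda>b v. representation B v b) ` B"
  shows "fun_space.independent D" "fun_space.span D = dual_space scale" "card D = card B"
proof -
  let ?r = "\<lambda>b v. representation B v b"
  have val: "?r b c = (if b = c then 1 else 0)" if "c \<in> B" for b c
    using representation_basis[OF assms(2) that] by auto
  have inj: "inj_on ?r B"
  proof (rule inj_onI)
    fix b c assume bc: "b \<in> B" "c \<in> B" "?r b = ?r c"
    then have "?r b b = ?r c b" by metis
    then show "b = c" using val[OF bc(1)] by (auto split: if_splits)
  qed
  then show "card D = card B" unfolding D_def by (rule card_image)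
  have finD: "finite D" using assms by simp
  have reindex: "(\<Sum>d\<in>D. fun_scale (u d) d) v = (\<Sum>b\<in>B. u (?r b) * ?r b v)" for u v
    using inj by (simp add: D_def sum.reindex fun_scale_def sum_fun_apply)
  show "fun_space.independent D"
    unfolding fun_space.dependent_finite[OF finD]
  proof (rule notI, elim exE conjE bexE)
    fix u d assume d: "d \<in> D" "u d \<noteq> 0" and u: "(\<Sum>d\<in>D. fun_scale (u d) d) = 0"
    \<comment> \<open>Evaluating the relation at the basis vector \<open>c\<close> leaves only the
      coefficient of the functional dual to \<open>c\<close>.\<close>
    then obtain c where c: "c \<in> B" "d = ?r c" unfolding D_def by blast
    have "(\<Sum>b\<in>B. u (?r b) * ?r b c) = 0" using reindex[of u c] u by simp
    moreover have "(\<Sum>b\<in>B. u (?r b) * ?r b c) = (\<Sum>b\<in>B. if b = c then u (?r b) else 0)"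
      using val[OF c(1)] by (intro sum.cong) auto
    ultimately have "u (?r c) = 0" using c assms(1) by simp
    then show False using c d by simp
  qed
  \<comment> \<open>\<open>Vector_Spaces.linear\<close> includes the axioms of the target space,
    here the field over itself.\<close>
  interpret F: vector_space "(*) :: 'a \<Rightarrow> 'a \<Rightarrow> 'a"
    by unfold_locales (auto simp: algebra_simps)
  have dual_iff: "f \<in> dual_space scale \<longleftrightarrow>
      (\<forall>x y. f (x + y) = f x + f y) \<and> (\<forall>c x. f (scale c x) = c * f x)" for f
    unfolding dual_space_def Vector_Spaces.linear_def module_hom_def module_hom_axioms_def
    using module_axioms F.module_axioms vector_space_axioms F.vector_space_axioms by auto
  have "fun_space.subspace (dual_space scale)"
  proof (rule fun_space.subspaceI)
    show "0 \<in> dual_space scale" unfolding dual_iff by simp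
  next
    fix f g assume "f \<in> dual_space scale" "g \<in> dual_space scale"
    then show "f + g \<in> dual_space scale"
      unfolding dual_iff plus_fun_apply by (metis add.assoc add.left_commute distrib_left)
  next
    fix c f assume "f \<in> dual_space scale"
    then show "fun_scale c f \<in> dual_space scale"
      unfolding dual_iff fun_scale_def by (metis distrib_left mult.left_commute)
  qed
  moreover have "?r b \<in> dual_space scale" for b
    using assms(2,3) by (simp add: dual_iff representation_add representation_scale)
  then have "D \<subseteq> dual_space scale" unfolding D_def by blast
  ultimately have "fun_space.span D \<subseteq> dual_space scale" by (metis fun_space.span_minimal)
  moreover have "f \<in> fun_space.span D" if f: "f \<in> dual_space scale" for f
  proof -
    interpret f: Vector_Spaces.linear scale "(*)" f using f by (simp add: dual_space_def)
    \<comment> \<open>The coefficients of a functional in the dual basis are its values on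
      \<open>B\<close>.\<close>
    have "f v = (\<Sum>b\<in>B. fun_scale (f b) (?r b)) v" for v
    proof -
      have "(\<Sum>b\<in>B. scale (?r b v) b) = v"
        using assms by (intro sum_representation_eq) auto
      then have "f v = f (\<Sum>b\<in>B. scale (?r b v) b)" by simp
      also have "\<dots> = (\<Sum>b\<in>B. ?r b v * f b)" by (simp add: f.sum f.scale)
      also have "\<dots> = (\<Sum>b\<in>B. fun_scale (f b) (?r b)) v"
        by (simp add: fun_scale_def sum_fun_apply mult.commute)
      finally show ?thesis .
    qed
    then have "f = (\<Sum>b\<in>B. fun_scale (f b) (?r b))" by (rule ext)
    also have "\<dots> \<in> fun_space.span D"
      by (intro fun_space.span_sum fun_space.span_scale fun_space.span_base) (simp add: D_def)
    finally show ?thesis .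
  qed
  ultimately show "fun_space.span D = dual_space scale" by blast
qed

end

section \<open>Elements of \<open>L\<close> and essentiality\<close>

context hyperplane_arrangement
begin

lemma dual_space_finitely_spanned:
  obtains D where "finite D" "fun_space.span D = dual_space scale"
    "fun_space.dim (dual_space scale) = dim UNIV"
proof -
  obtain T where "finite T" "span T = UNIV" using finite_dimensional by blast
  then obtain B where B: "independent B" "UNIV \<subseteq> span B" "finite B" "card B = dim UNIV"
    using finite_basis_exists[of T UNIV] by (metis subset_UNIV subset_antisym)
  then have "span B = UNIV" by blast
  note D = dual_space_basis[OF B(3,1) this]
  show thesis
    using that[OF _ D(2)] B D fun_space.dim_span_eq_card_independent[OF D(1)] by simp
qed

lemma subspace_L: "X \<in> L \<Longrightarrow> fun_space.subspace X"
  by (auto simp: L_def)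

lemma subspace_dual_space: "fun_space.subspace (dual_space scale)"
  by (metis dual_space_finitely_spanned fun_space.subspace_span)

lemma L_subset_dual_space:
  assumes "X \<in> L"
  shows "X \<subseteq> dual_space scale"
proof -
  obtain B where B: "B \<subseteq> A" "X = fun_space.span (\<Union>B)" using assms by (auto simp: L_def)
  then have "\<Union>B \<subseteq> dual_space scale" using dual_A by blast
  then show ?thesis unfolding B(2) by (rule fun_space.span_minimal[OF _ subspace_dual_space])
qed

lemma modular_Int:
  assumes "modular M" "modular N"
  shows "modular (M \<inter> N)"
  using assms by (auto simp: modular_def Int_assoc)

lemma L_nonzero_contains_atom:
  assumes "X \<in> L" "X \<noteq> {0}"
  obtains H where "H \<in> A" "H \<subseteq> X"
proof -
  obtain B where B: "B \<subseteq> A" "X = fun_space.span (\<Union>B)" using assms by (auto simp: L_def)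
  \<comment> \<open>An empty \<open>B\<close> would give the zero space.\<close>
  with assms obtain H where "H \<in> B" by fastforce
  with B show thesis using that fun_space.span_superset[of "\<Union>B"] by blast
qed

lemma dim_L_subset: "Y \<in> L \<Longrightarrow> X \<subseteq> Y \<Longrightarrow> fun_space.dim X \<le> fun_space.dim Y"
  by (metis dual_space_finitely_spanned L_subset_dual_space fun_space.dim_subset_finitely_spanned)

lemma L_dim_equal:
  assumes "X \<in> L" "Y \<in> L" "X \<subseteq> Y" "fun_space.dim X = fun_space.dim Y"
  shows "X = Y"
  by (metis assms subspace_L dual_space_finitely_spanned L_subset_dual_space
      fun_space.subspace_dim_equal_finitely_spanned)

lemma zero_in_L: "{0} \<in> L"
  unfolding L_def by (intro CollectI exI[of _ "{}"]) auto

text \<open>Essentiality: for some \<open>H\<close> in the nonempty \<open>A\<close>, a modular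
  \<open>M\<close> of codimension 1 misses a vector of \<open>H\<close>, so the sum of
  \<open>M\<close> and \<open>H\<close> is the whole dual space. Adding \<open>H\<close> to the
  generators of \<open>M\<close> shows that this sum lies in \<open>L\<close>.\<close>

lemma dual_space_in_L:
  assumes enough_modular_elements
  shows "dual_space scale \<in> L"
proof -
  obtain H where H: "H \<in> A" using nonempty_A by blast
  then obtain M where M: "modular M" "fun_space.dim M + 1 = fun_space.dim (dual_space scale)"
      "\<not> H \<subseteq> M"
    using assms unfolding enough_modular_elements_def by blast
  then have M_L: "M \<in> L" by (simp add: modular_def)
  then obtain B where B: "B \<subseteq> A" "M = fun_space.span (\<Union>B)" by (auto simp: L_def)
  obtain a where a: "a \<in> H" "a \<notin> M" using M by blast
  obtain D where D: "finite D" "fun_space.span D = dual_space scale"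
    using dual_space_finitely_spanned by blast
  let ?Y = "fun_space.span (\<Union>(insert H B))"
  have YL: "?Y \<in> L" unfolding L_def using B H by blast
  have "fun_space.span (insert a M) = dual_space scale"
    using D M a H dual_A subspace_L[OF M_L] L_subset_dual_space[OF M_L] subspace_dual_space
    by (intro fun_space.span_insert_codim_1[of D]) auto
  moreover have "insert a M \<subseteq> ?Y"
    using a B fun_space.span_superset[of "\<Union>(insert H B)"]
      fun_space.span_mono[of "\<Union>B" "\<Union>(insert H B)"] by blast
  then have "fun_space.span (insert a M) \<subseteq> ?Y"
    by (simp add: fun_space.span_minimal)
  ultimately show ?thesis using L_subset_dual_space[OF YL] YL by auto
qed

section \<open>Construction of the modular chain\<close>

lemma modular_descent:
  assumes enough_modular_elements "modular X" "fun_space.dim X = Suc n"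
  obtains Y where "modular Y" "fun_space.dim Y = n" "Y \<subset> X"
proof -
  have XL: "X \<in> L" using assms by (simp add: modular_def)
  have "X \<noteq> {0}" using assms by (auto simp: fun_space.dim_zero)
  then obtain H where H: "H \<in> A" "H \<subseteq> X" using L_nonzero_contains_atom[OF XL] by blast
  then obtain M where M: "modular M" "fun_space.dim M + 1 = fun_space.dim (dual_space scale)"
      "\<not> H \<subseteq> M"
    using assms unfolding enough_modular_elements_def by blast
  then have M_L: "M \<in> L" by (simp add: modular_def)
  obtain D where D: "finite D" "fun_space.span D = dual_space scale"
    using dual_space_finitely_spanned by blast
  \<comment> \<open>\<open>X\<close> is not contained in \<open>M\<close>, because it contains
    \<open>H\<close>.\<close>
  have "fun_space.dim (X \<inter> M) + 1 = fun_space.dim X"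
    using D M H subspace_L XL M_L L_subset_dual_space subspace_dual_space
    by (intro fun_space.dim_Int_codim_1[of D "dual_space scale"]) auto
  moreover have "X \<inter> M \<subset> X" using M H by blast
  ultimately show thesis using that[OF modular_Int[OF assms(2) M(1)]] assms(3) by simp
qed

text \<open>The chain is built downwards from \<open>X\<close>, so the induction on the dimension
  keeps \<open>X\<close> arbitrary. Recording that the \<open>i\<close>-th member has dimension
  \<open>i\<close> prepares the proof of maximality.\<close>

lemma modular_chain_exists:
  assumes enough_modular_elements "modular X" "fun_space.dim X = n"
  shows "\<exists>Y. Y 0 = {0} \<and> Y n = X \<and> (\<forall>i<n. Y i \<subset> Y (Suc i)) \<and>
    (\<forall>i\<le>n. modular (Y i) \<and> fun_space.dim (Y i) = i)"
  using assms(2,3)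
proof (induction n arbitrary: X)
  case 0
  then have XL: "X \<in> L" by (simp add: modular_def)
  have "{0} \<subseteq> X" using fun_space.subspace_0[OF subspace_L[OF XL]] by simp
  then have "{0} = X" by (rule L_dim_equal[OF zero_in_L XL]) (simp add: 0 fun_space.dim_zero)
  then show ?case using 0 by (intro exI[of _ "\<lambda>_. X"]) auto
next
  case (Suc n)
  obtain X' where X': "modular X'" "fun_space.dim X' = n" "X' \<subset> X"
    using modular_descent[OF assms(1) Suc.prems] .
  obtain Y where Y: "Y 0 = {0}" "Y n = X'" "\<forall>i<n. Y i \<subset> Y (Suc i)"
      "\<forall>i\<le>n. modular (Y i) \<and> fun_space.dim (Y i) = i"
    using Suc.IH[OF X'(1,2)] by blast
  \<comment> \<open>The chain ending in \<open>X'\<close> is kept up to index \<open>n\<close>; only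
    its value at \<open>Suc n\<close> is replaced, by \<open>X\<close>.\<close>
  then show ?case using X' Suc.prems
    by (intro exI[of _ "Y(Suc n := X)"]) (auto simp: less_Suc_eq le_Suc_eq)
qed

section \<open>Maximality of the chain\<close>

text \<open>A member \<open>Z\<close> of a larger chain is comparable with the \<open>X i\<close> of
  the same dimension, and comparable elements of \<open>L\<close> of equal dimension
  coincide.\<close>

lemma maxchain_if_all_dims:
  assumes "\<forall>i<n. X i \<subset> X (Suc i)" "\<forall>i\<le>n. X i \<in> L \<and> fun_space.dim (X i) = i"
    and "X n = dual_space scale"
  shows "subset.maxchain L (X ` {..n})"
proof -
  have mono: "X i \<subseteq> X j" if "i \<le> j" "j \<le> n" for i j
    using that
  proof (induction j rule: dec_induct)
    case (step j)
    then show ?case using assms(1) by (metis Suc_le_lessD less_imp_le order_trans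
        psubset_imp_subset)
  qed simp
  have "subset.chain L (X ` {..n})"
    unfolding subset_chain_def
  proof (intro conjI ballI)
    fix Y Z assume "Y \<in> X ` {..n}" "Z \<in> X ` {..n}"
    then obtain i j where ij: "Y = X i" "Z = X j" "i \<le> n" "j \<le> n" by auto
    then show "Y \<subseteq> Z \<or> Z \<subseteq> Y" using mono nat_le_linear[of i j] by metis
  qed (use assms(2) in auto)
  moreover have "Z \<in> X ` {..n}"
    if C: "subset.chain L C" "X ` {..n} \<subseteq> C" and Z: "Z \<in> C" for C Z
  proof -
    have ZL: "Z \<in> L" using C Z by (auto simp: subset_chain_def)
    \<comment> \<open>The top \<open>X n\<close> contains \<open>Z\<close>, so
      \<open>fun_space.dim Z\<close> is a valid index of the chain.\<close>
    have "X n \<in> L" using assms by blast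
    then have "fun_space.dim Z \<le> n"
      using dim_L_subset[of "X n" Z] L_subset_dual_space[OF ZL] assms by auto
    then have i: "X (fun_space.dim Z) \<in> L" "fun_space.dim (X (fun_space.dim Z)) = fun_space.dim Z"
        "X (fun_space.dim Z) \<in> X ` {..n}"
      using assms by auto
    then have "X (fun_space.dim Z) \<subseteq> Z \<or> Z \<subseteq> X (fun_space.dim Z)"
      using C Z unfolding subset_chain_def by blast
    then have "X (fun_space.dim Z) = Z" using L_dim_equal ZL i by metis
    then show ?thesis using i by metis
  qed
  ultimately show ?thesis unfolding subset.maxchain_def by blast
qed

lemma enough_modular_elements_imp_supersolvable:
  assumes enough_modular_elements
  shows supersolvable
proof -
  have VL: "dual_space scale \<in> L" using dual_space_in_L[OF assms] .
  \<comment> \<open>Intersecting with the dual space fixes every element of \<open>L\<close>, so the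
    descent can start at the top.\<close>
  have "modular (dual_space scale)"
    using VL L_subset_dual_space by (auto simp: modular_def Int_absorb1)
  moreover have "fun_space.dim (dual_space scale) = dim UNIV"
    using dual_space_finitely_spanned by blast
  ultimately obtain X where X: "X 0 = {0}" "X (dim UNIV) = dual_space scale"
      "\<forall>i<dim UNIV. X i \<subset> X (Suc i)"
      "\<forall>i\<le>dim UNIV. modular (X i) \<and> fun_space.dim (X i) = i"
    using modular_chain_exists[OF assms] by metis
  moreover have "subset.maxchain L (X ` {..dim UNIV})"
    using X by (intro maxchain_if_all_dims) (auto simp: modular_def)
  ultimately show ?thesis
    using VL unfolding supersolvable_def essential_def by blast
qed

end

theorem lemma1p4p3:
  fixes \<iota> :: "'k::field \<Rightarrow> complex"
    and scale :: "'k \<Rightarrow> 'v::ab_group_add \<Rightarrow> 'v"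
    and A :: "('v \<Rightarrow> 'k) set set"
  assumes "complex_embedding \<iota>"
    and "hyperplane_arrangement scale A"
    and "hyperplane_arrangement.enough_modular_elements scale A"
  shows "hyperplane_arrangement.supersolvable scale A"
  using assms(2,3) by (rule hyperplane_arrangement.enough_modular_elements_imp_supersolvable)

end
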